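(* Let $n\geq1$ and let $f$ be a real-valued function defined in a neighbourhood of infinity that is $n$-times continuously differentiable on $(t_0,\infty)$ for some $t_0>0$. Define $L_0(t)=f(t)$ and $L_k(t)=t\,L_{k-1}'(t)$ for $k\in\{1,\ldots,n\}$, where $'$ denotes the derivative. If $L_n$ is eventually of constant sign and if $|L_n|$ is slowly varying, then the column vector $\boldsymbol{L}=(L_1,\ldots,L_n)^{\top}$ is a regularly varying rate vector with index matrix $\boldsymbol{J}_n$, the $n\times n$ Jordan block with $(\boldsymbol{J}_n)_{i,i+1}=1$ for $i\in\{1,\ldots,n-1\}$ and all other entries zero, and $f\in\Pi(\boldsymbol{L})$ with $\boldsymbol{L}$-index $\boldsymbol{c}=(1,0,\ldots,0)$.
   Context: Limit relations are as $t\to\infty$; measurability is Lebesgue. A positive measurable function $F$ defined in a neighbourhood of infinity is slowly varying if $F(xt)/F(t)\to1$ for every $x>0$. A real function is defined in a neighbourhood of infinity if its domain contains some $[t_0,\infty)$; it is eventually of constant sign if it is either strictly positive for all large $t$ or strictly negative for all large $t$. A rate vector of length $n$ is a column vector $\boldsymbol{g}$ with components $g_1,\ldots,g_n$, real-valued functions defined in a neighbourhood of infinity, each eventually of constant sign, with $g_{i+1}(t)=o(g_i(t))$ for every $i\in\{1,\ldots,n-1\}$; $o(g_n(t))$ means $o(|g_n(t)|)$, componentwise for vectors. For a square matrix $\boldsymbol{B}$ and $x>0$, $x^{\boldsymbol{B}}=\exp\{(\log x)\boldsymbol{B}\}$. An index matrix is an upper triangular $\boldsymbol{B}\in\mathbb{R}^{n\times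 n}$ whose diagonal elements are non-increasing and all of whose eigenvalues, except possibly the smallest one, have geometric multiplicity one. A rate vector $\boldsymbol{g}$ is regularly varying with index matrix $\boldsymbol{B}$ if $\boldsymbol{g}$ is measurable and $\boldsymbol{g}(xt)=x^{\boldsymbol{B}}\boldsymbol{g}(t)+o(g_n(t))$ for every $x\in(0,\infty)$. For such $\boldsymbol{g}$ with $\boldsymbol{B}$ having zero diagonal, $f\in\Pi(\boldsymbol{g})$ with $\boldsymbol{g}$-index $\boldsymbol{c}\in\mathbb{R}^{1\times n}$ means that $f$ is a measurable real-valued function defined in a neighbourhood of infinity and for every $x\in(0,\infty)$, $f(xt)=f(t)+\boldsymbol{h}(x)\boldsymbol{g}(t)+o(g_n(t))$ with $\boldsymbol{h}(x)=\boldsymbol{c}\int_1^x y^{\boldsymbol{B}}y^{-1}\,\mathrm{d}y$. *)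

theory Defs
  imports
    "HOL-Analysis.Analysis"
    "HOL-Library.Landau_Symbols"
    "Jordan_Normal_Form.Matrix_Kernel"
    "Jordan_Normal_Form.Spectral_Radius"
begin

text \<open>
  Vectors and matrices are those of \<open>Jordan_Normal_Form.Matrix\<close>, with explicit dimensions and
  indices starting at 0: the component \<open>g\<^sub>i\<close> of a rate vector is \<open>g t $ (i - 1)\<close>.

  A real function defined in a neighbourhood of infinity is represented by a total function
  \<open>real \<Rightarrow> real\<close> of which only the values at all large arguments matter; accordingly
  measurability, positivity and constancy of sign are required on some \<open>[a, \<infinity>)\<close> only.
\<close>

unbundle no vec_syntax

definition measurable_near_infinity :: "(real \<Rightarrow> real) \<Rightarrow> bool" where
  "measurable_near_infinity F \<longleftrightarrow> (\<exists>a. F \<in> borel_measurable (lebesgue_on {a..}))"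

definition slowly_varying :: "(real \<Rightarrow> real) \<Rightarrow> bool" where
  "slowly_varying F \<longleftrightarrow>
     measurable_near_infinity F \<and> (\<forall>\<^sub>F t in at_top. F t > 0) \<and>
     (\<forall>x>0. ((\<lambda>t. F (x * t) / F t) \<longlongrightarrow> 1) at_top)"

definition eventually_constant_sign :: "(real \<Rightarrow> real) \<Rightarrow> bool" where
  "eventually_constant_sign F \<longleftrightarrow>
     (\<forall>\<^sub>F t in at_top. F t > 0) \<or> (\<forall>\<^sub>F t in at_top. F t < 0)"

definition rate_vector :: "nat \<Rightarrow> (real \<Rightarrow> real Matrix.vec) \<Rightarrow> bool" where
  "rate_vector n g \<longleftrightarrow>
     (\<forall>t. g t \<in> carrier_vec n) \<and>
     (\<forall>i<n. eventually_constant_sign (\<lambda>t. g t $ i)) \<and>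
     (\<forall>i. Suc i < n \<longrightarrow> (\<lambda>t. g t $ Suc i) \<in> o[at_top](\<lambda>t. g t $ i))"

text \<open>
  The matrix type carries no norm, so the exponential series is summed entrywise.
\<close>

definition mat_exp :: "real Matrix.mat \<Rightarrow> real Matrix.mat" where
  "mat_exp B = Matrix.mat (dim_row B) (dim_col B)
     (\<lambda>(i, j). \<Sum>k. (B ^\<^sub>m k) $$ (i, j) / fact k)"

definition mat_powr :: "real \<Rightarrow> real Matrix.mat \<Rightarrow> real Matrix.mat" where
  "mat_powr x B = mat_exp (ln x \<cdot>\<^sub>m B)"

definition geometric_multiplicity :: "real Matrix.mat \<Rightarrow> real \<Rightarrow> nat" where
  "geometric_multiplicity B \<mu> = kernel_dim (char_matrix B \<mu>)"

text \<open>
  The eigenvalues of an upper triangular real matrix are its (real) diagonal entries, so the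
  real spectrum contains all of them.
\<close>

definition index_matrix :: "nat \<Rightarrow> real Matrix.mat \<Rightarrow> bool" where
  "index_matrix n B \<longleftrightarrow>
     B \<in> carrier_mat n n \<and> upper_triangular B \<and>
     (\<forall>i j. i \<le> j \<and> j < n \<longrightarrow> B $$ (j, j) \<le> B $$ (i, i)) \<and>
     (\<forall>\<mu> \<in> spectrum B - {Min (spectrum B)}. geometric_multiplicity B \<mu> = 1)"

definition regularly_varying :: "nat \<Rightarrow> (real \<Rightarrow> real Matrix.vec) \<Rightarrow> real Matrix.mat \<Rightarrow> bool" where
  "regularly_varying n g B \<longleftrightarrow>
     rate_vector n g \<and> index_matrix n B \<and>
     (\<forall>i<n. measurable_near_infinity (\<lambda>t. g t $ i)) \<and>
     (\<forall>x>0. \<forall>i<n. (\<lambda>t. (g (x * t) - mat_powr x B *\<^sub>v g t) $ i)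
        \<in> o[at_top](\<lambda>t. g t $ (n - 1)))"

text \<open>
  The function \<open>h\<close>, with values in the \<open>1 \<times> n\<close> matrices. The integral is oriented, so for
  \<open>x < 1\<close> it is minus the integral over \<open>(x, 1)\<close>.
\<close>

definition Pi_h :: "real Matrix.mat \<Rightarrow> real Matrix.mat \<Rightarrow> real \<Rightarrow> real Matrix.mat" where
  "Pi_h B c x = c * Matrix.mat (dim_row B) (dim_col B)
     (\<lambda>(i, j). LBINT y=1..x. mat_powr y B $$ (i, j) * inverse y)"

definition Pi_class ::
  "nat \<Rightarrow> (real \<Rightarrow> real Matrix.vec) \<Rightarrow> real Matrix.mat \<Rightarrow> real Matrix.mat \<Rightarrow> (real \<Rightarrow> real) set" where
  "Pi_class n g B c = {f.
     regularly_varying n g B \<and> (\<forall>i<n. B $$ (i, i) = 0) \<and> c \<in> carrier_mat 1 n \<and>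
     measurable_near_infinity f \<and>
     (\<forall>x>0. (\<lambda>t. f (x * t) - f t - (Pi_h B c x *\<^sub>v g t) $ 0) \<in> o[at_top](\<lambda>t. g t $ (n - 1)))}"

text \<open>For open \<open>S\<close>, where the total \<open>deriv\<close> is the derivative on \<open>S\<close>.\<close>

definition n_times_cont_differentiable_on :: "nat \<Rightarrow> (real \<Rightarrow> real) \<Rightarrow> real set \<Rightarrow> bool" where
  "n_times_cont_differentiable_on n f S \<longleftrightarrow>
     (\<forall>k<n. \<forall>t\<in>S. (deriv ^^ k) f differentiable (at t)) \<and>
     (\<forall>k\<le>n. continuous_on S ((deriv ^^ k) f))"

fun L :: "(real \<Rightarrow> real) \<Rightarrow> nat \<Rightarrow> real \<Rightarrow> real" where
  "L f 0 = f"
| "L f (Suc k) = (\<lambda>t. t * deriv (L f k) t)"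

definition L_vec :: "nat \<Rightarrow> (real \<Rightarrow> real) \<Rightarrow> real \<Rightarrow> real Matrix.vec" where
  "L_vec n f t = Matrix.vec n (\<lambda>i. L f (Suc i) t)"

end

theory Submission
  imports Defs
begin

text \<open>
  In the variable \<open>s = ln t\<close> the functions \<open>L\<^sub>k\<close> become the successive derivatives of \<open>f (exp s)\<close>. By
  the uniform convergence theorem \<open>L\<^sub>n\<close> varies slowly uniformly over bounded shifts of \<open>s\<close>, so Taylor's
  theorem with Lagrange remainder of order \<open>n\<close> gives both expansions with error \<open>o(L\<^sub>n)\<close>. An
  antiderivative \<open>g\<close> of a slowly varying positive \<open>u\<close> is eventually monotone, hence of constant sign,
  and comparing \<open>g s\<close> with \<open>g (s - B)\<close> or \<open>g (s + B)\<close>, according to that sign, shows \<open>u = o(g)\<close>; so \<open>g\<close>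
  varies slowly too, and this descends from \<open>L\<^sub>n\<close> to \<open>L\<^sub>1\<close>.
\<close>

section \<open>Uniform convergence under bounded shifts\<close>

text \<open>
  By Baire's theorem, convergence at speed \<open>N\<close> holds for all shifts in some ball; subtracting the
  centre of the ball moves it to \<open>0\<close>, and finitely many translates cover \<open>[-A, A]\<close>.
\<close>

lemma local_uniform_convergence_additive:
  fixes v :: "real \<Rightarrow> real"
  assumes cont: "continuous_on {c<..} v"
    and lim: "\<And>a. ((\<lambda>s. v (s + a) - v s) \<longlongrightarrow> 0) at_top"
    and e: "e > 0"
  shows "\<forall>\<^sub>F s in at_top. \<forall>a\<in>{-A..A}. \<bar>v (s + a) - v s\<bar> < e"
proof -
  \<comment> \<open>For \<open>a\<close> in \<open>E N\<close>, convergence has set in from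
    \<open>c + 1 + real N\<close> on; as \<open>\<bar>a\<bar> \<le> real N\<close>, all points
    \<open>s + a\<close> then stay beyond \<open>c\<close>, where \<open>v\<close> is continuous.
    The tolerance \<open>e / 3\<close> is spent three times.\<close>
  define E where "E N = {a \<in> cball 0 (real N). \<forall>s \<ge> c + 1 + real N. \<bar>v (s + a) - v s\<bar> \<le> e / 3}" for N :: nat
  have closed_E: "closed (E N)" for N
  proof -
    have "E N = cball 0 (real N) \<inter>
      (\<Inter>s\<in>{c + 1 + real N..}. {a \<in> cball 0 (real N). \<bar>v (s + a) - v s\<bar> \<le> e / 3})"
      by (auto simp: E_def)
    moreover have "closed {a \<in> cball 0 (real N). \<bar>v (s + a) - v s\<bar> \<le> e / 3}"
      if s: "s \<ge> c + 1 + real N" for s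
    proof (intro continuous_on_closed_Collect_le continuous_intros closed_cball)
      show "continuous_on (cball 0 (real N)) (\<lambda>a. v (s + a))"
        by (rule continuous_on_compose2[OF cont])
           (use s in \<open>auto intro!: continuous_intros simp: dist_real_def\<close>)
    qed
    ultimately show ?thesis
      by (auto intro!: closed_Int closed_INT)
  qed
  have cover: "\<exists>N. a \<in> E N" for a
  proof -
    have "\<forall>\<^sub>F s in at_top. \<bar>v (s + a) - v s\<bar> < e / 3"
      using tendstoD[OF lim[of a], of "e / 3"] e by (simp add: dist_real_def)
    then obtain M where M: "\<And>s. s \<ge> M \<Longrightarrow> \<bar>v (s + a) - v s\<bar> < e / 3"
      by (auto simp: eventually_at_top_linorder)
    obtain N :: nat where N: "real N \<ge> max \<bar>a\<bar> (M - c - 1)"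
      using real_arch_simple by blast
    then have "a \<in> E N"
      using M by (auto simp: E_def intro!: less_imp_le)
    then show ?thesis ..
  qed
  obtain N where "interior (E N) \<noteq> {}"
  proof (rule ccontr)
    assume "\<not> thesis"
    with that have empty: "interior (E N) = {}" for N
      by blast
    \<comment> \<open>If every closed \<open>E N\<close> had empty interior, the complements would
      be open and dense, and by Baire so would their intersection be dense; but it is empty because
      the \<open>E N\<close> cover the line.\<close>
    have "UNIV \<subseteq> closure (\<Inter>(range (\<lambda>N. - E N)))"
      by (rule Baire) (use closed_E empty in \<open>auto simp: closure_complement\<close>)
    moreover have "\<Inter>(range (\<lambda>N. - E N)) = {}"
      using cover by auto
    ultimately show False
      by simp
  qed
  then obtain p d where d: "d > 0" and ball: "ball p d \<subseteq> E N"
    by (auto simp: mem_interior)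
  define M where "M = c + 1 + real N + p"
  have small: "\<bar>v (s + b) - v s\<bar> \<le> 2 * e / 3" if "s \<ge> M" "\<bar>b\<bar> < d" for s b
  proof -
    \<comment> \<open>Both \<open>v (s + b)\<close> and \<open>v s\<close> are compared with
      \<open>v (s - p)\<close>: the shifts \<open>p + b\<close> and \<open>p\<close> lie in the
      ball, and \<open>s \<ge> M\<close> puts the base point \<open>s - p\<close> in the range of
      \<open>E N\<close>.\<close>
    have in_E: "p + b \<in> E N" "p \<in> E N"
      using ball that(2) d by (auto simp: subset_iff dist_real_def)
    have "s - p \<ge> c + 1 + real N"
      using that(1) by (simp add: M_def)
    then have "\<bar>v ((s - p) + (p + b)) - v (s - p)\<bar> \<le> e / 3" "\<bar>v ((s - p) + p) - v (s - p)\<bar> \<le> e / 3"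
      using in_E unfolding E_def by blast+
    moreover have "(s - p) + (p + b) = s + b" "(s - p) + p = s"
      by simp_all
    ultimately show ?thesis
      by (simp only:)
  qed
  obtain K where K: "finite K" "K \<subseteq> {-A..A}" "{-A..A} \<subseteq> (\<Union>k\<in>K. ball k d)"
    using compactE_image[of "{-A..A}" "{-A..A}" "\<lambda>k. ball k d"] d
    by (metis (no_types, lifting) UN_I centre_in_ball compact_Icc open_ball subsetI)
  \<comment> \<open>For the finite set \<open>K\<close> of centres pointwise convergence is enough;
    \<open>s \<ge> M + A\<close> then yields \<open>s + k \<ge> M\<close>, since
    \<open>k \<ge> - A\<close>.\<close>
  have "\<forall>\<^sub>F s in at_top. \<forall>k\<in>K. \<bar>v (s + k) - v s\<bar> < e / 3"
    using tendstoD[OF lim, of "e / 3"] e K(1)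
    by (auto intro!: eventually_ball_finite simp: dist_real_def)
  moreover have "\<forall>\<^sub>F s in at_top. s \<ge> M + A"
    by (rule eventually_ge_at_top)
  ultimately show ?thesis
  proof eventually_elim
    case (elim s)
    show ?case
    proof
      fix a assume "a \<in> {-A..A}"
      with K obtain k where k: "k \<in> K" "\<bar>a - k\<bar> < d"
        by (force simp: dist_real_def)
      then have "s + k \<ge> M"
        using K(2) elim(2) by force
      with k(2) have "\<bar>v (s + a) - v (s + k)\<bar> \<le> 2 * e / 3"
        using small[of "s + k" "a - k"] by simp
      moreover have "\<bar>v (s + k) - v s\<bar> < e / 3"
        using elim(1) k(1) by blast
      ultimately show "\<bar>v (s + a) - v s\<bar> < e"
        by linarith
    qed
  qed
qed

section \<open>Slow variation and Taylor expansion in the logarithmic variable\<close>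

text \<open>Slow variation in the variable \<open>s = ln t\<close>, for signed continuous functions.\<close>

definition additively_slowly_varying :: "(real \<Rightarrow> real) \<Rightarrow> bool" where
  "additively_slowly_varying u \<longleftrightarrow>
     eventually_constant_sign u \<and> (\<exists>c. continuous_on {c<..} u) \<and>
     (\<forall>a. ((\<lambda>s. u (s + a) / u s) \<longlongrightarrow> 1) at_top)"

lemma eventually_constant_sign_cong:
  assumes "\<forall>\<^sub>F t in at_top. F t = G t"
  shows "eventually_constant_sign F \<longleftrightarrow> eventually_constant_sign G"
  unfolding eventually_constant_sign_def
  by (intro arg_cong2[of _ _ _ _ "(\<or>)"] eventually_cong[OF assms]) simp_all

lemma eventually_constant_sign_uminus:
  "eventually_constant_sign (\<lambda>t. - F t) \<longleftrightarrow> eventually_constant_sign F"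
  by (auto simp: eventually_constant_sign_def)

lemma additively_slowly_varying_uminus:
  "additively_slowly_varying (\<lambda>t. - u t) \<longleftrightarrow> additively_slowly_varying u"
proof -
  have "continuous_on S (\<lambda>t. - u t) \<longleftrightarrow> continuous_on S u" for S
    using continuous_on_minus[of S u] continuous_on_minus[of S "\<lambda>t. - u t"] by auto
  then show ?thesis
    by (simp add: additively_slowly_varying_def eventually_constant_sign_uminus)
qed

text \<open>Taking \<open>ln \<bar>u s\<bar>\<close> turns ratios into differences, to which local
  uniform convergence applies; continuity of \<open>exp\<close> at 0 turns the result back into a
  relative error.\<close>

lemma additively_slowly_varying_uniform:
  assumes u: "additively_slowly_varying u" and e: "e > 0"
  shows "\<forall>\<^sub>F s in at_top. \<forall>a\<in>{-A..A}. \<bar>u (s + a) - u s\<bar> \<le> e * \<bar>u s\<bar>"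
proof -
  obtain c where c: "continuous_on {c<..} u"
    using u by (auto simp: additively_slowly_varying_def)
  obtain S where S: "(\<forall>s\<ge>S. u s > 0) \<or> (\<forall>s\<ge>S. u s < 0)"
    using u by (auto simp: additively_slowly_varying_def eventually_constant_sign_def
        eventually_at_top_linorder)
  have lim: "((\<lambda>s. ln \<bar>u (s + a)\<bar> - ln \<bar>u s\<bar>) \<longlongrightarrow> 0) at_top" for a
  proof -
    have "((\<lambda>s. ln \<bar>u (s + a) / u s\<bar>) \<longlongrightarrow> ln \<bar>1\<bar>) at_top"
      by (intro tendsto_intros) (use u in \<open>auto simp: additively_slowly_varying_def\<close>)
    moreover have "\<forall>\<^sub>F s in at_top. ln \<bar>u (s + a) / u s\<bar> = ln \<bar>u (s + a)\<bar> - ln \<bar>u s\<bar>"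
      using eventually_ge_at_top[of "S + \<bar>a\<bar>"]
    proof eventually_elim
      case (elim s)
      then have "u s \<noteq> 0" "u (s + a) \<noteq> 0"
        using S by (smt (verit))+
      then show ?case
        by (simp add: abs_divide ln_div)
    qed
    ultimately show ?thesis
      by (simp add: filterlim_cong)
  qed
  have "isCont exp (0::real)"
    by simp
  then obtain r where r: "r > 0" "\<And>z. \<bar>z\<bar> < r \<Longrightarrow> \<bar>exp z - 1\<bar> < (e::real)"
    using e unfolding continuous_at_eps_delta by (auto simp: dist_real_def)
  have "continuous_on {max c S<..} (\<lambda>s. ln \<bar>u s\<bar>)"
  proof (intro continuous_intros continuous_on_subset[OF c])
    show "\<forall>s\<in>{max c S<..}. \<bar>u s\<bar> \<noteq> 0"
    proof
      fix s assume "s \<in> {max c S<..}"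
      then have "s \<ge> S"
        by simp
      then show "\<bar>u s\<bar> \<noteq> 0"
        using S by (smt (verit))
    qed
  qed auto
  from local_uniform_convergence_additive[OF this lim r(1), of A]
  have "\<forall>\<^sub>F s in at_top. \<forall>a\<in>{-A..A}. \<bar>ln \<bar>u (s + a)\<bar> - ln \<bar>u s\<bar>\<bar> < r" .
  moreover have "\<forall>\<^sub>F s in at_top. s \<ge> S + \<bar>A\<bar>"
    by (rule eventually_ge_at_top)
  ultimately show ?thesis
  proof eventually_elim
    case (elim s)
    show ?case
    proof
      fix a assume a: "a \<in> {-A..A}"
      have pos: "u (s + a) / u s > 0" and nz: "u s \<noteq> 0" "u (s + a) \<noteq> 0"
        using S elim(2) a by (auto simp: zero_less_divide_iff) (smt (verit))+
      have "u (s + a) / u s = exp (ln \<bar>u (s + a)\<bar> - ln \<bar>u s\<bar>)"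
        using pos nz by (simp add: exp_diff abs_divide[symmetric] del: abs_divide)
      then have "\<bar>u (s + a) / u s - 1\<bar> < e"
        using r(2) elim(1) a by simp
      then have "\<bar>u (s + a) / u s - 1\<bar> * \<bar>u s\<bar> \<le> e * \<bar>u s\<bar>"
        by (intro mult_right_mono) auto
      then show "\<bar>u (s + a) - u s\<bar> \<le> e * \<bar>u s\<bar>"
        unfolding abs_mult[symmetric] using nz by (simp add: left_diff_distrib)
    qed
  qed
qed

text \<open>The intermediate point \<open>s + b\<close> of the Lagrange remainder varies with
  \<open>s\<close>; uniformity over \<open>\<bar>b\<bar> \<le> \<bar>a\<bar>\<close> is what lets
  \<open>D m (s + b)\<close> be replaced by \<open>D m s\<close>.\<close>

lemma additively_slowly_varying_Taylor:
  fixes D :: "nat \<Rightarrow> real \<Rightarrow> real"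
  assumes D: "\<And>k s. k < m \<Longrightarrow> s > c \<Longrightarrow> (D k has_real_derivative D (Suc k) s) (at s)"
    and u: "additively_slowly_varying (D m)"
  shows "(\<lambda>s. D 0 (s + a) - (\<Sum>k\<le>m. a ^ k / fact k * D k s)) \<in> o[at_top](D m)"
proof (rule landau_o.smallI)
  fix e :: real assume e: "e > 0"
  \<comment> \<open>The added 1 keeps \<open>C\<close> positive when \<open>a ^ m\<close> vanishes,
    so that \<open>e / C\<close> is a valid tolerance.\<close>
  define C where "C = \<bar>a\<bar> ^ m / fact m + 1"
  have C: "C > 0"
    unfolding C_def by (intro add_nonneg_pos) auto
  have "\<forall>\<^sub>F s in at_top. \<forall>b\<in>{-\<bar>a\<bar>..\<bar>a\<bar>}. \<bar>D m (s + b) - D m s\<bar> \<le> e / C * \<bar>D m s\<bar>"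
    by (rule additively_slowly_varying_uniform[OF u]) (use e C in simp)
  moreover have "\<forall>\<^sub>F s in at_top. s > c + \<bar>a\<bar>"
    by (rule eventually_gt_at_top)
  ultimately show "\<forall>\<^sub>F s in at_top.
      norm (D 0 (s + a) - (\<Sum>k\<le>m. a ^ k / fact k * D k s)) \<le> e * norm (D m s)"
  proof eventually_elim
    case (elim s)
    have "\<exists>b\<in>{-\<bar>a\<bar>..\<bar>a\<bar>}. D 0 (s + a) = (\<Sum>k<m. a ^ k / fact k * D k s) + a ^ m / fact m * D m (s + b)"
    \<comment> \<open>In the degenerate cases \<open>b = a\<close> works: the sum is empty for
      \<open>m = 0\<close>, and for \<open>a = 0 < m\<close> only its term at 0 survives. Otherwise
      Taylor's theorem applies.\<close>
    proof (cases "m = 0 \<or> a = 0")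
      case True
      then show ?thesis
        by (cases m) (auto simp del: sum.lessThan_Suc simp: sum.lessThan_Suc_shift intro!: bexI[of _ a])
    next
      case False
      then have "\<exists>t. (if s + a < s then s + a < t \<and> t < s else s < t \<and> t < s + a) \<and>
          D 0 (s + a) = (\<Sum>k<m. (D k s / fact k) * (s + a - s) ^ k) + (D m t / fact m) * (s + a - s) ^ m"
        using elim(2) D by (intro Taylor[of m D "D 0" "s - \<bar>a\<bar>" "s + \<bar>a\<bar>" s "s + a"]) auto
      then obtain t where "if s + a < s then s + a < t \<and> t < s else s < t \<and> t < s + a"
          and eq: "D 0 (s + a) = (\<Sum>k<m. (D k s / fact k) * (s + a - s) ^ k) + (D m t / fact m) * (s + a - s) ^ m"
        by blast
      then have "t - s \<in> {-\<bar>a\<bar>..\<bar>a\<bar>}"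
        by (auto split: if_splits)
      then show ?thesis
        using eq by (intro bexI[of _ "t - s"]) (auto simp: mult.commute)
    qed
    then obtain b where b: "b \<in> {-\<bar>a\<bar>..\<bar>a\<bar>}"
      "D 0 (s + a) = (\<Sum>k<m. a ^ k / fact k * D k s) + a ^ m / fact m * D m (s + b)"
      by blast
    have "D 0 (s + a) - (\<Sum>k\<le>m. a ^ k / fact k * D k s) = a ^ m / fact m * (D m (s + b) - D m s)"
      unfolding b(2) lessThan_Suc_atMost[symmetric] by (simp add: algebra_simps)
    then have "norm (D 0 (s + a) - (\<Sum>k\<le>m. a ^ k / fact k * D k s))
        = \<bar>a\<bar> ^ m / fact m * \<bar>D m (s + b) - D m s\<bar>"
      by (simp add: abs_mult power_abs)
    also have "\<dots> \<le> C * (e / C * \<bar>D m s\<bar>)"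
      using elim(1) b(1) C by (intro mult_mono) (auto simp: C_def)
    finally show ?case
      using C by simp
  qed
qed

section \<open>Antiderivatives of slowly varying functions\<close>

lemma additively_slowly_varying_increment:
  assumes u: "additively_slowly_varying u"
    and deriv: "\<And>s. s > c \<Longrightarrow> (g has_real_derivative u s) (at s)"
  shows "(\<lambda>s. g (s + a) - g s - a * u s) \<in> o[at_top](u)"
proof -
  define D where "D k = (if k = 0 then g else u)" for k :: nat
  have "(\<lambda>s. D 0 (s + a) - (\<Sum>k\<le>1. a ^ k / fact k * D k s)) \<in> o[at_top](D 1)"
    by (rule additively_slowly_varying_Taylor[of _ c]) (use u deriv in \<open>auto simp: D_def\<close>)
  then show ?thesis
    by (simp add: D_def algebra_simps)
qed

lemma additively_slowly_varying_antiderivative_pos: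
  assumes u: "additively_slowly_varying u" and pos: "\<forall>\<^sub>F s in at_top. u s > 0"
    and deriv: "\<And>s. s > c \<Longrightarrow> (g has_real_derivative u s) (at s)"
  shows "eventually_constant_sign g \<and> u \<in> o[at_top](g)"
proof -
  have incr: "(\<lambda>s. g (s + a) - g s - a * u s) \<in> o[at_top](u)" for a
    using u deriv by (rule additively_slowly_varying_increment)
  obtain S where S: "S > c" "\<And>s. s \<ge> S \<Longrightarrow> u s > 0"
  proof -
    obtain S0 where "\<And>s. s \<ge> S0 \<Longrightarrow> u s > 0"
      using pos by (auto simp: eventually_at_top_linorder)
    then show ?thesis
      by (intro that[of "max S0 (c + 1)"]) auto
  qed
  have mono: "g s < g t" if "S \<le> s" "s < t" for s t
  proof (rule DERIV_pos_imp_increasing[OF that(2)])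
    fix x assume "s \<le> x"
    then have "x \<ge> S" "x > c"
      using S(1) that(1) by simp_all
    then show "\<exists>y. (g has_real_derivative y) (at x) \<and> y > 0"
      using S(2) deriv by blast
  qed
  show ?thesis
  \<comment> \<open>As \<open>g\<close> increases strictly beyond \<open>S\<close>, it is either
    positive after some \<open>s1\<close> or negative throughout.\<close>
  proof (cases "\<exists>s1\<ge>S. g s1 \<ge> 0")
    case True
    then obtain s1 where s1: "s1 \<ge> S" "g s1 \<ge> 0"
      by blast
    have gpos: "g s > 0" if "s > s1" for s
      using mono[of s1 s] s1 that by simp
    have "u \<in> o[at_top](g)"
    proof (rule landau_o.smallI)
      fix e :: real assume e: "e > 0"
      \<comment> \<open>A shift of length \<open>2 / e\<close> with error at most
        \<open>u s / e\<close> leaves \<open>u s / e\<close> to spare: \<open>g s\<close> exceeds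
        the positive value \<open>g (s - 2 / e)\<close> by at least that much.\<close>
      have "\<forall>\<^sub>F s in at_top. norm (g (s + (- 2 / e)) - g s - (- 2 / e) * u s) \<le> 1 / e * norm (u s)"
        by (rule landau_o.smallD[OF incr]) (use e in simp)
      moreover have "\<forall>\<^sub>F s in at_top. s > s1 + 2 / e"
        by (rule eventually_gt_at_top)
      ultimately show "\<forall>\<^sub>F s in at_top. norm (u s) \<le> e * norm (g s)"
      proof eventually_elim
        case (elim s)
        have "s > s1"
          using elim(2) e by (smt (verit) divide_pos_pos)
        then have pos: "g (s + (- 2 / e)) > 0" "g s > 0" "u s > 0"
          using gpos S(2) elim(2) s1 by auto
        define q where "q = u s / e"
        have "\<bar>g (s - 2 / e) - g s + 2 * q\<bar> \<le> q"
          using elim(1) pos by (simp add: q_def)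
        then have "u s / e \<le> g s"
          using pos by (simp add: q_def)
        then show ?case
          using e pos by (simp add: field_simps)
      qed
    qed
    moreover have "eventually_constant_sign g"
    proof -
      have "\<forall>\<^sub>F s in at_top. g s > 0"
        using eventually_gt_at_top[of s1] by eventually_elim (rule gpos)
      then show ?thesis
        by (simp add: eventually_constant_sign_def)
    qed
    ultimately show ?thesis
      by blast
  next
    case False
    then have gneg: "g s < 0" if "s \<ge> S" for s
      using that by force
    have "u \<in> o[at_top](g)"
    proof (rule landau_o.smallI)
      fix e :: real assume e: "e > 0"
      \<comment> \<open>Now \<open>g\<close> is negative, so the comparison looks ahead:
        \<open>- g s\<close> exceeds the positive value \<open>- g (s + 2 / e)\<close> by at least
        \<open>u s / e\<close>.\<close>
      have "\<forall>\<^sub>F s in at_top. norm (g (s + 2 / e) - g s - 2 / e * u s) \<le> 1 / e * norm (u s)"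
        by (rule landau_o.smallD[OF incr]) (use e in simp)
      moreover have "\<forall>\<^sub>F s in at_top. s \<ge> S"
        by (rule eventually_ge_at_top)
      ultimately show "\<forall>\<^sub>F s in at_top. norm (u s) \<le> e * norm (g s)"
      proof eventually_elim
        case (elim s)
        then have "s + 2 / e \<ge> S"
          using e by (smt (verit) divide_pos_pos)
        then have pos: "g (s + 2 / e) < 0" "g s < 0" "u s > 0"
          using gneg S(2) elim(2) by auto
        define q where "q = u s / e"
        have "\<bar>g (s + 2 / e) - g s - 2 * q\<bar> \<le> q"
          using elim(1) pos by (simp add: q_def)
        then have "u s / e \<le> - g s"
          using pos by (simp add: q_def)
        then show ?case
          using e pos by (simp add: field_simps)
      qed
    qed
    moreover have "eventually_constant_sign g"
    proof -
      have "\<forall>\<^sub>F s in at_top. g s < 0"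
        using eventually_ge_at_top[of S] by eventually_elim (rule gneg)
      then show ?thesis
        by (simp add: eventually_constant_sign_def)
    qed
    ultimately show ?thesis
      by blast
  qed
qed


text \<open>Negating \<open>u\<close> and \<open>g\<close> reduces to positive \<open>u\<close>.
  Once \<open>u\<close> is small against \<open>g\<close>, so is the increment
  \<open>g (s + a) - g s\<close>, which is \<open>a * u s\<close> up to a smaller error; hence the
  ratio tends to 1.\<close>

lemma additively_slowly_varying_antiderivative:
  assumes u: "additively_slowly_varying u"
    and deriv: "\<And>s. s > c \<Longrightarrow> (g has_real_derivative u s) (at s)"
  shows "additively_slowly_varying g" "u \<in> o[at_top](g)"
proof -
  have sign: "eventually_constant_sign g \<and> u \<in> o[at_top](g)"
  proof (cases "\<forall>\<^sub>F s in at_top. u s > 0")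
    case True
    with u deriv show ?thesis
      by (intro additively_slowly_varying_antiderivative_pos)
  next
    case False
    then have "\<forall>\<^sub>F s in at_top. - u s > 0"
      using u by (auto simp: additively_slowly_varying_def eventually_constant_sign_def)
    then have "eventually_constant_sign (\<lambda>s. - g s) \<and> (\<lambda>s. - u s) \<in> o[at_top](\<lambda>s. - g s)"
      using u deriv
      by (intro additively_slowly_varying_antiderivative_pos[of _ c])
         (auto simp: additively_slowly_varying_uminus intro: DERIV_minus)
    then show ?thesis
      by (simp add: eventually_constant_sign_uminus)
  qed
  then show small: "u \<in> o[at_top](g)" ..
  have "continuous_on {c<..} g"
    by (rule DERIV_continuous_on) (auto intro: DERIV_subset[OF deriv])
  moreover have "((\<lambda>s. g (s + a) / g s) \<longlongrightarrow> 1) at_top" for a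
  proof -
    have "(\<lambda>s. g (s + a) - g s - a * u s) \<in> o[at_top](g)"
      by (rule landau_o.small_trans[OF additively_slowly_varying_increment small]) (use u deriv in auto)
    moreover have "(\<lambda>s. a * u s) \<in> o[at_top](g)"
      using small by (cases "a = 0") auto
    ultimately have "(\<lambda>s. (g (s + a) - g s - a * u s) + a * u s) \<in> o[at_top](g)"
      by (rule sum_in_smallo)
    then have "((\<lambda>s. (g (s + a) - g s) / g s) \<longlongrightarrow> 0) at_top"
      by (auto dest: smalloD_tendsto)
    then have "((\<lambda>s. (g (s + a) - g s) / g s + 1) \<longlongrightarrow> 0 + 1) at_top"
      by (intro tendsto_intros)
    moreover have "\<forall>\<^sub>F s in at_top. g s \<noteq> 0"
      using sign by (auto simp: eventually_constant_sign_def elim!: eventually_mono)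
    then have "\<forall>\<^sub>F s in at_top. (g (s + a) - g s) / g s + 1 = g (s + a) / g s"
      by eventually_elim (simp add: field_simps)
    ultimately show ?thesis
      by (simp add: filterlim_cong)
  qed
  ultimately show "additively_slowly_varying g"
    using sign by (auto simp: additively_slowly_varying_def)
qed

text \<open>Downward induction from \<open>n\<close>: each \<open>D k\<close> is an antiderivative
  of \<open>D (Suc k)\<close> beyond \<open>c\<close>.\<close>

lemma additively_slowly_varying_lower_derivatives:
  fixes D :: "nat \<Rightarrow> real \<Rightarrow> real"
  assumes D: "\<And>k s. k < n \<Longrightarrow> s > c \<Longrightarrow> (D k has_real_derivative D (Suc k) s) (at s)"
    and u: "additively_slowly_varying (D n)"
  shows "k \<le> n \<Longrightarrow> additively_slowly_varying (D k)"
    and "k < n \<Longrightarrow> D (Suc k) \<in> o[at_top](D k)"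
proof -
  show *: "additively_slowly_varying (D k)" if "k \<le> n" for k
    using that
  proof (induction rule: inc_induct)
    case (step k)
    then show ?case
      using additively_slowly_varying_antiderivative(1)[OF _ D[OF step.hyps(2)]] by blast
  qed (rule u)
  show "D (Suc k) \<in> o[at_top](D k)" if "k < n" for k
    using additively_slowly_varying_antiderivative(2)[OF * D[OF that]] that by simp
qed

section \<open>Smoothness of the functions \<open>L f k\<close>\<close>

lemma n_times_cont_differentiable_on_DERIV:
  assumes "n_times_cont_differentiable_on n f S" "j < n" "t \<in> S"
  shows "((deriv ^^ j) f has_real_derivative (deriv ^^ Suc j) f t) (at t)"
  using assms by (simp add: n_times_cont_differentiable_on_def DERIV_deriv_iff_real_differentiable)

text \<open>Termwise product rule. At \<open>j = 0\<close> the exponent \<open>j - 1\<close>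
  truncates to 0, which the factor \<open>real j\<close> makes harmless.\<close>

lemma DERIV_sum_power_deriv:
  fixes f :: "real \<Rightarrow> real"
  assumes "n_times_cont_differentiable_on n f S" "k < n" "t \<in> S"
  shows "((\<lambda>t. \<Sum>j\<le>k. c j * t ^ j * (deriv ^^ j) f t) has_real_derivative
    (\<Sum>j\<le>k. c j * (real j * t ^ (j - 1) * (deriv ^^ j) f t + t ^ j * (deriv ^^ Suc j) f t))) (at t)"
  by (rule DERIV_sum)
     (use assms in \<open>auto intro!: derivative_eq_intros n_times_cont_differentiable_on_DERIV[where n = n and S = S]
        simp: algebra_simps\<close>)

text \<open>The coefficients are the Stirling numbers of the second kind; only their existence matters.\<close>

lemma L_eq_sum_power_deriv:
  assumes f: "n_times_cont_differentiable_on n f S" and S: "open S"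
  shows "k \<le> n \<Longrightarrow> \<exists>c. \<forall>t\<in>S. L f k t = (\<Sum>j\<le>k. c j * t ^ j * (deriv ^^ j) f t)"
proof (induction k)
  case 0
  show ?case
    by (intro exI[of _ "\<lambda>_. 1"]) simp
next
  case (Suc k)
  then obtain c where c: "\<And>t. t \<in> S \<Longrightarrow> L f k t = (\<Sum>j\<le>k. c j * t ^ j * (deriv ^^ j) f t)"
    by auto
  \<comment> \<open>Applying \<open>t * d/dt\<close> to the term of index \<open>j\<close> gives
    \<open>j\<close> times that term plus the term of index \<open>j + 1\<close>. Values of
    \<open>c\<close> beyond \<open>k\<close> are unspecified, hence the cutoff in the first
    summand.\<close>
  define c' where "c' j = (if j \<le> k then c j * real j else 0) + (if j = 0 then 0 else c (j - 1))" for j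
  have "L f (Suc k) t = (\<Sum>j\<le>Suc k. c' j * t ^ j * (deriv ^^ j) f t)" if t: "t \<in> S" for t
  proof -
    have "(L f k has_real_derivative
        (\<Sum>j\<le>k. c j * (real j * t ^ (j - 1) * (deriv ^^ j) f t + t ^ j * (deriv ^^ Suc j) f t))) (at t)"
      by (rule has_field_derivative_transform_within_open[OF DERIV_sum_power_deriv[OF f] S])
         (use Suc.prems t c in auto)
    then have "L f (Suc k) t =
        (\<Sum>j\<le>k. t * (c j * (real j * t ^ (j - 1) * (deriv ^^ j) f t + t ^ j * (deriv ^^ Suc j) f t)))"
      by (simp add: DERIV_imp_deriv sum_distrib_left)
    also have "\<dots> = (\<Sum>j\<le>k. c j * real j * t ^ j * (deriv ^^ j) f t)
        + (\<Sum>j\<le>k. c j * t ^ Suc j * (deriv ^^ Suc j) f t)"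
      unfolding sum.distrib[symmetric]
    proof (rule sum.cong)
      fix j
      show "t * (c j * (real j * t ^ (j - 1) * (deriv ^^ j) f t + t ^ j * (deriv ^^ Suc j) f t)) =
          c j * real j * t ^ j * (deriv ^^ j) f t + c j * t ^ Suc j * (deriv ^^ Suc j) f t"
        by (cases j) (simp_all add: algebra_simps del: funpow.simps)
    qed simp
    also have "(\<Sum>j\<le>k. c j * real j * t ^ j * (deriv ^^ j) f t) =
        (\<Sum>j\<le>Suc k. (if j \<le> k then c j * real j else 0) * t ^ j * (deriv ^^ j) f t)"
      by simp
    also have "(\<Sum>j\<le>k. c j * t ^ Suc j * (deriv ^^ Suc j) f t) =
        (\<Sum>j\<le>Suc k. (if j = 0 then 0 else c (j - 1)) * t ^ j * (deriv ^^ j) f t)"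
      unfolding sum.atMost_Suc_shift by simp
    finally show ?thesis
      unfolding c'_def by (simp only: sum.distrib[symmetric] distrib_right)
  qed
  then show ?case
    by blast
qed

lemma continuous_on_L:
  assumes f: "n_times_cont_differentiable_on n f S" and S: "open S" and k: "k \<le> n"
  shows "continuous_on S (L f k)"
proof -
  obtain c where c: "\<And>t. t \<in> S \<Longrightarrow> L f k t = (\<Sum>j\<le>k. c j * t ^ j * (deriv ^^ j) f t)"
    using L_eq_sum_power_deriv[OF f S k] by blast
  have "continuous_on S (\<lambda>t. \<Sum>j\<le>k. c j * t ^ j * (deriv ^^ j) f t)"
    by (intro continuous_intros) (use f k in \<open>auto simp: n_times_cont_differentiable_on_def\<close>)
  then show ?thesis
    using c by (simp cong: continuous_on_cong)
qed

text \<open>Since \<open>deriv\<close> is total, differentiability needs proof: on the open set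
  \<open>S\<close>, \<open>L f k\<close> is a combination of derivatives of order at most
  \<open>k < n\<close>, all differentiable there.\<close>

lemma DERIV_L:
  assumes f: "n_times_cont_differentiable_on n f S" and S: "open S" and k: "k < n" and t: "t \<in> S"
  shows "(L f k has_real_derivative deriv (L f k) t) (at t)"
proof -
  obtain c where c: "\<And>t. t \<in> S \<Longrightarrow> L f k t = (\<Sum>j\<le>k. c j * t ^ j * (deriv ^^ j) f t)"
    using L_eq_sum_power_deriv[OF f S] k by (meson less_imp_le)
  have "(L f k has_real_derivative
      (\<Sum>j\<le>k. c j * (real j * t ^ (j - 1) * (deriv ^^ j) f t + t ^ j * (deriv ^^ Suc j) f t))) (at t)"
    by (rule has_field_derivative_transform_within_open[OF DERIV_sum_power_deriv[OF f k t] S t])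
       (use c in auto)
  from this DERIV_imp_deriv[OF this] show ?thesis
    by simp
qed

section \<open>The substitution \<open>t = exp s\<close>\<close>

lemma DERIV_L_exp:
  assumes f: "n_times_cont_differentiable_on n f {t0<..}" and "t0 > 0" "k < n" "s > ln t0"
  shows "((\<lambda>s. L f k (exp s)) has_real_derivative L f (Suc k) (exp s)) (at s)"
proof -
  have "exp s \<in> {t0<..}"
    using assms exp_less_mono[of "ln t0" s] by simp
  \<comment> \<open>The factor \<open>exp s\<close> from the chain rule is the factor
    \<open>t\<close> in the recursion for \<open>L\<close>.\<close>
  from DERIV_chain2[OF DERIV_L[OF f _ \<open>k < n\<close> this] DERIV_exp] show ?thesis
    by (simp add: mult.commute)
qed

lemma additively_slowly_varying_compose_exp:
  assumes cont: "continuous_on {t0<..} F" and t0: "t0 > 0"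
    and sign: "eventually_constant_sign F" and slow: "slowly_varying (\<lambda>t. \<bar>F t\<bar>)"
  shows "additively_slowly_varying (\<lambda>s. F (exp s))"
proof -
  have "continuous_on {ln t0<..} (\<lambda>s. F (exp s))"
  proof (rule continuous_on_compose2[OF cont])
    show "exp ` {ln t0<..} \<subseteq> {t0<..}"
      using t0 exp_less_mono[of "ln t0"] by auto
  qed (intro continuous_intros)
  moreover have sign': "eventually_constant_sign (\<lambda>s. F (exp s))"
    using sign unfolding eventually_constant_sign_def
    by (auto dest: eventually_compose_filterlim[OF _ exp_at_top])
  moreover have "((\<lambda>s. F (exp (s + a)) / F (exp s)) \<longlongrightarrow> 1) at_top" for a
  proof -
    have "((\<lambda>t. \<bar>F (exp a * t)\<bar> / \<bar>F t\<bar>) \<longlongrightarrow> 1) at_top"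
      using slow by (simp add: slowly_varying_def)
    then have lim: "((\<lambda>s. \<bar>F (exp a * exp s)\<bar> / \<bar>F (exp s)\<bar>) \<longlongrightarrow> 1) at_top"
      by (rule filterlim_compose[OF _ exp_at_top])
    obtain S where S: "(\<forall>s\<ge>S. F (exp s) > 0) \<or> (\<forall>s\<ge>S. F (exp s) < 0)"
      using sign' by (auto simp: eventually_constant_sign_def eventually_at_top_linorder)
    \<comment> \<open>Both \<open>s\<close> and \<open>s + a\<close> eventually lie beyond
      \<open>S\<close>, where the sign is constant, so the absolute values cancel in the
      quotient.\<close>
    have "\<forall>\<^sub>F s in at_top. \<bar>F (exp a * exp s)\<bar> / \<bar>F (exp s)\<bar> = F (exp (s + a)) / F (exp s)"
      using eventually_ge_at_top[of "S + \<bar>a\<bar>"]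
    proof eventually_elim
      case (elim s)
      then have "s \<ge> S" "s + a \<ge> S"
        by simp_all
      then have "F (exp s) > 0 \<and> F (exp (s + a)) > 0 \<or> F (exp s) < 0 \<and> F (exp (s + a)) < 0"
        using S by blast
      then show ?case
        by (auto simp: exp_add mult.commute)
    qed
    with lim show ?thesis
      by (simp add: filterlim_cong)
  qed
  ultimately show ?thesis
    by (auto simp: additively_slowly_varying_def)
qed

lemma smallo_at_top_expD:
  fixes F G :: "real \<Rightarrow> real"
  assumes "(\<lambda>s. F (exp s)) \<in> o[at_top](\<lambda>s. G (exp s))"
  shows "F \<in> o[at_top](G)"
proof -
  have "(\<lambda>t. F (exp (ln t))) \<in> o[at_top](\<lambda>t. G (exp (ln t)))"
    by (rule landau_o.small.compose[OF assms ln_at_top])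
  moreover have F: "\<forall>\<^sub>F t in at_top. F (exp (ln t)) = F t"
    and G: "\<forall>\<^sub>F t in at_top. G (exp (ln t)) = G t"
    using eventually_gt_at_top[of "0::real"] by (eventually_elim, simp)+
  ultimately show ?thesis
    unfolding landau_o.small.cong[OF G] landau_o.small.in_cong[OF F] by simp
qed

section \<open>Powers, spectrum and integrals for the Jordan block\<close>

lemma pow_smult_mat:
  fixes A :: "'a :: comm_semiring_1 mat"
  assumes A: "A \<in> carrier_mat n n"
  shows "(a \<cdot>\<^sub>m A) ^\<^sub>m k = a ^ k \<cdot>\<^sub>m A ^\<^sub>m k"
proof (induction k)
  case 0
  show ?case
    using A by auto
next
  case (Suc k)
  have Ak: "A ^\<^sub>m k \<in> carrier_mat n n"
    using A by simp
  have "(a \<cdot>\<^sub>m A) ^\<^sub>m Suc k = a \<cdot>\<^sub>m (a ^ k \<cdot>\<^sub>m (A ^\<^sub>m k * A))"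
    using A Ak Suc by (simp add: mult_smult_distrib[of _ n n _ n] mult_smult_assoc_mat[of _ n n _ n])
  also have "\<dots> = a ^ Suc k \<cdot>\<^sub>m A ^\<^sub>m Suc k"
    by (rule eq_matI) (simp_all add: mult.assoc mult.left_commute)
  finally show ?case .
qed

text \<open>The \<open>k\<close>-th power of the nilpotent block has ones on the \<open>k\<close>-th
  superdiagonal only, so at each entry the exponential series has at most one nonzero term.\<close>

lemma mat_powr_jordan_block_zero:
  assumes "i < n" "j < n"
  shows "mat_powr x (jordan_block n 0) $$ (i, j) =
    (if i \<le> j then ln x ^ (j - i) / fact (j - i) else 0)"
proof -
  \<comment> \<open>For \<open>i > j\<close> the difference \<open>j - i\<close> truncates to 0; the
    inner conditional supplies the value 0 there.\<close>
  have "((ln x \<cdot>\<^sub>m jordan_block n 0) ^\<^sub>m k) $$ (i, j) / fact k =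
      (if k = j - i then if i \<le> j then ln x ^ k / fact k else 0 else 0)" for k
    using assms by (simp add: pow_smult_mat[of _ n] jordan_block_zero_pow)
  moreover have "(\<lambda>k. if k = j - i then if i \<le> j then ln x ^ k / fact k else 0 else 0) sums
      (if i \<le> j then ln x ^ (j - i) / fact (j - i) else 0)"
    by (rule sums_single)
  ultimately show ?thesis
    using assms by (simp add: mat_powr_def mat_exp_def sums_unique[symmetric])
qed

text \<open>The only possible eigenvalue is \<open>a\<close>, which is then the smallest, so no
  eigenvalue is left to check for multiplicity. The empty spectrum covers
  \<open>n = 0\<close>.\<close>

lemma index_matrix_jordan_block: "index_matrix n (jordan_block n a)"
proof -
  have "\<mu> = a" if "\<mu> \<in> spectrum (jordan_block n a)" for \<mu>
    using that by (auto simp: spectrum_def eigenvalue_root_char_poly[of _ n] jordan_block_char_poly)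
  then have "spectrum (jordan_block n a) = {} \<or> spectrum (jordan_block n a) = {a}"
    by blast
  then have "spectrum (jordan_block n a) - {Min (spectrum (jordan_block n a))} = {}"
    by auto
  then show ?thesis
    by (auto simp: index_matrix_def)
qed

text \<open>The integrand is the derivative of the right-hand side, whose value at 1 is 0; the
  oriented integral covers \<open>x < 1\<close>.\<close>

lemma interval_integral_ln_power_div:
  assumes "x > 0"
  shows "(LBINT y=1..x. ln y ^ j / fact j * inverse y) = ln x ^ Suc j / fact (Suc j)"
proof -
  have "(LBINT y=ereal 1..ereal x. ln y ^ j / fact j * inverse y)
      = ln x ^ Suc j / fact (Suc j) - ln 1 ^ Suc j / fact (Suc j)"
  proof (rule interval_integral_FTC_finite)
    show "continuous_on {min 1 x..max 1 x} (\<lambda>y. ln y ^ j / fact j * inverse y)"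
      using assms by (intro continuous_intros) auto
    fix y assume "min 1 x \<le> y"
    then have "y > 0"
      using assms by simp
    then have "((\<lambda>y. ln y ^ Suc j / fact (Suc j)) has_real_derivative
        (1 + real j) * (inverse y * ln y ^ j) / fact (Suc j)) (at y within {min 1 x..max 1 x})"
      by (intro DERIV_cdivide DERIV_power_Suc DERIV_subset[OF DERIV_ln]) auto
    moreover have "(1 + real j) * (inverse y * ln y ^ j) / fact (Suc j) = ln y ^ j / fact j * inverse y"
    proof -
      have "fact (Suc j) = (1 + real j) * fact j" "1 + real j \<noteq> 0"
        by simp_all
      then show ?thesis
        by (simp only: mult_divide_mult_cancel_left) simp
    qed
    ultimately show "((\<lambda>y. ln y ^ Suc j / fact (Suc j)) has_vector_derivative
        ln y ^ j / fact j * inverse y) (at y within {min 1 x..max 1 x})"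
      by (simp add: has_real_derivative_iff_has_vector_derivative[symmetric] del: fact_Suc power_Suc)
  qed
  then show ?thesis
    by (simp add: one_ereal_def)
qed

section \<open>Regular variation and membership in the class Pi\<close>

theorem theorem6p2:
  fixes f :: "real \<Rightarrow> real" and n :: nat and t0 :: real
  assumes "n \<ge> 1"
    and "t0 > 0"
    and "n_times_cont_differentiable_on n f {t0<..}"
    and "eventually_constant_sign (L f n)"
    and "slowly_varying (\<lambda>t. \<bar>L f n t\<bar>)"
  shows "regularly_varying n (L_vec n f) (jordan_block n 0)
    \<and> f \<in> Pi_class n (L_vec n f) (jordan_block n 0) (mat_of_row (unit_vec n 0))"
proof -
  define D where "D k s = L f k (exp s)" for k s
  have D: "(D k has_real_derivative D (Suc k) s) (at s)" if "k < n" "s > ln t0" for k s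
    using DERIV_L_exp[OF assms(3,2) that] by (simp add: D_def[abs_def])
  have Dn: "additively_slowly_varying (D n)"
    unfolding D_def[abs_def] using assms
    by (intro additively_slowly_varying_compose_exp[of t0] continuous_on_L) auto
  have sign: "eventually_constant_sign (L f k)" if "k \<le> n" for k
  proof -
    have "eventually_constant_sign (D k)"
      using additively_slowly_varying_lower_derivatives(1)[OF D Dn that]
      by (simp add: additively_slowly_varying_def)
    then have "eventually_constant_sign (\<lambda>t. D k (ln t))"
      unfolding eventually_constant_sign_def
      by (auto dest: eventually_compose_filterlim[OF _ ln_at_top])
    moreover have "\<forall>\<^sub>F t in at_top. D k (ln t) = L f k t"
      using eventually_gt_at_top[of 0] by eventually_elim (simp add: D_def)
    ultimately show ?thesis
      using eventually_constant_sign_cong[of "\<lambda>t. D k (ln t)" "L f k"] by simp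
  qed
  have small: "L f (Suc k) \<in> o[at_top](L f k)" if "k < n" for k
    using additively_slowly_varying_lower_derivatives(2)[OF D Dn that]
    unfolding D_def[abs_def] by (rule smallo_at_top_expD)
  \<comment> \<open>One expansion serves both claims: \<open>k = 0\<close> for the class Pi,
    \<open>k = Suc i\<close> for row \<open>i\<close> of regular variation.\<close>
  have expansion: "(\<lambda>t. L f k (x * t) - (\<Sum>j\<le>n - k. ln x ^ j / fact j * L f (k + j) t)) \<in> o[at_top](L f n)"
    if "k \<le> n" "x > 0" for k x
  proof (rule smallo_at_top_expD)
    \<comment> \<open>Taylor expansion of order \<open>n - k\<close> for the sequence starting at
      \<open>D k\<close>, with shift \<open>ln x\<close>, because
      \<open>x * exp s = exp (s + ln x)\<close>.\<close>
    have "(\<lambda>s. D (k + 0) (s + ln x) - (\<Sum>j\<le>n - k. ln x ^ j / fact j * D (k + j) s))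
        \<in> o[at_top](D (k + (n - k)))"
      by (rule additively_slowly_varying_Taylor[of "n - k" "ln t0" "\<lambda>j. D (k + j)"])
         (use D Dn that in auto)
    then show "(\<lambda>s. L f k (x * exp s) - (\<Sum>j\<le>n - k. ln x ^ j / fact j * L f (k + j) (exp s)))
        \<in> o[at_top](\<lambda>s. L f n (exp s))"
      using that by (simp add: D_def[abs_def] exp_add mult.commute)
  qed
  have meas: "measurable_near_infinity (L f k)" if "k \<le> n" for k
    unfolding measurable_near_infinity_def
    \<comment> \<open>The closed half-line from \<open>t0 + 1\<close> lies inside the open one on
      which \<open>L f k\<close> is continuous.\<close>
    by (intro exI[of _ "t0 + 1"] continuous_imp_measurable_on_sets_lebesgue
        continuous_on_subset[OF continuous_on_L[OF assms(3) _ that]]) auto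
  have rv: "regularly_varying n (L_vec n f) (jordan_block n 0)"
    unfolding regularly_varying_def
  proof (intro conjI allI impI)
    show "rate_vector n (L_vec n f)"
      using sign small by (simp add: rate_vector_def L_vec_def del: L.simps)
    show "index_matrix n (jordan_block n 0)"
      by (rule index_matrix_jordan_block)
    show "measurable_near_infinity (\<lambda>t. L_vec n f t $ i)" if "i < n" for i
      using meas[of "Suc i"] that by (simp add: L_vec_def del: L.simps)
  next
    fix x :: real and i assume x: "x > 0" and i: "i < n"
    have "(L_vec n f (x * t) - mat_powr x (jordan_block n 0) *\<^sub>v L_vec n f t) $ i =
        L f (Suc i) (x * t) - (\<Sum>j\<le>n - Suc i. ln x ^ j / fact j * L f (Suc i + j) t)" for t
    proof -
      have dim: "dim_row (mat_powr x (jordan_block n 0)) = n" "dim_col (mat_powr x (jordan_block n 0)) = n"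
        by (simp_all add: mat_powr_def mat_exp_def)
      have "(mat_powr x (jordan_block n 0) *\<^sub>v L_vec n f t) $ i =
          (\<Sum>j = 0..<n. if i \<le> j then ln x ^ (j - i) / fact (j - i) * L f (Suc j) t else 0)"
        using i by (auto simp: dim scalar_prod_def L_vec_def mat_powr_jordan_block_zero
            simp del: L.simps intro!: sum.cong)
      \<comment> \<open>Only columns from \<open>i\<close> on contribute; counting them from
        \<open>i\<close> gives the Taylor sum, whose last index \<open>n - Suc i\<close> belongs to
        \<open>L f n\<close>.\<close>
      also have "\<dots> = (\<Sum>j\<in>{i..<n}. ln x ^ (j - i) / fact (j - i) * L f (Suc j) t)"
        by (rule sum.mono_neutral_cong_right) auto
      also have "\<dots> = (\<Sum>j\<le>n - Suc i. ln x ^ j / fact j * L f (Suc i + j) t)"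
        by (rule sum.reindex_bij_witness[of _ "\<lambda>j. i + j" "\<lambda>j. j - i"]) (use i in auto)
      finally show ?thesis
        using i by (simp add: dim L_vec_def del: L.simps)
    qed
    then show "(\<lambda>t. (L_vec n f (x * t) - mat_powr x (jordan_block n 0) *\<^sub>v L_vec n f t) $ i)
        \<in> o[at_top](\<lambda>t. L_vec n f t $ (n - 1))"
      using expansion[of "Suc i" x] x i by (simp add: L_vec_def del: L.simps)
  qed
  have "f \<in> Pi_class n (L_vec n f) (jordan_block n 0) (mat_of_row (unit_vec n 0))"
    unfolding Pi_class_def
  proof (intro CollectI conjI allI impI rv)
    show "measurable_near_infinity f"
      using meas[of 0] by simp
    fix x :: real assume x: "x > 0"
    \<comment> \<open>The unit row vector selects the first row of the matrix of integrals, with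
      integrands \<open>ln y ^ j / fact j * inverse y\<close>.\<close>
    have Pi_h: "Pi_h (jordan_block n 0) (mat_of_row (unit_vec n 0)) x $$ (0, j) = ln x ^ Suc j / fact (Suc j)"
      if "j < n" for j
      using that assms(1) interval_integral_ln_power_div[OF x, of j]
      by (simp add: Pi_h_def mat_powr_jordan_block_zero)
    have "(Pi_h (jordan_block n 0) (mat_of_row (unit_vec n 0)) x *\<^sub>v L_vec n f t) $ 0 =
        (\<Sum>j = 0..<n. ln x ^ Suc j / fact (Suc j) * L f (Suc j) t)" for t
    proof -
      have "dim_row (Pi_h (jordan_block n 0) (mat_of_row (unit_vec n 0)) x) = 1"
        "dim_col (Pi_h (jordan_block n 0) (mat_of_row (unit_vec n 0)) x) = n"
        by (simp_all add: Pi_h_def)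
      then show ?thesis
        by (auto simp: scalar_prod_def L_vec_def Pi_h simp del: L.simps fact_Suc power_Suc intro!: sum.cong)
    qed
    \<comment> \<open>The term at 0 is \<open>f t\<close>; the remaining ones, shifted by one, form
      the product of \<open>Pi_h\<close> with \<open>L_vec\<close>.\<close>
    moreover have "(\<Sum>j\<le>n. ln x ^ j / fact j * L f j t) =
        f t + (\<Sum>j = 0..<n. ln x ^ Suc j / fact (Suc j) * L f (Suc j) t)" for t
      using assms(1)
      by (cases n) (simp_all add: sum.atMost_Suc_shift atLeast0LessThan lessThan_Suc_atMost del: L.simps(2) fact_Suc power_Suc sum.atMost_Suc)
    ultimately show "(\<lambda>t. f (x * t) - f t - (Pi_h (jordan_block n 0) (mat_of_row (unit_vec n 0)) x *\<^sub>v L_vec n f t) $ 0)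
        \<in> o[at_top](\<lambda>t. L_vec n f t $ (n - 1))"
      using expansion[of 0 x] x assms(1) by (simp add: L_vec_def algebra_simps del: L.simps(2))
  qed simp_all
  with rv show ?thesis
    by blast
qed

end
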